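(* Let $L$ be a finite-dimensional Leibniz algebra over a field $F$ in which every subalgebra is a weak quasi-ideal of $L$. Then $L/\phi(L)$ is abelian or almost abelian.
   Context: A (right) Leibniz algebra over a field $F$ is a vector space $L$ with a bilinear product $[\cdot,\cdot]$ satisfying $[x,[y,z]]=[[x,y],z]-[[x,z],y]$ for all $x,y,z$. A Leibniz algebra is abelian if all its products are zero. A subalgebra $U$ of $L$ is a weak quasi-ideal of $L$ if $[U,V]+[V,U]\subseteq U+V$ for every subalgebra $V$ of $L$. The Frattini ideal $\phi(L)$ is the largest ideal of $L$ contained in the intersection of all maximal subalgebras of $L$. A Leibniz algebra $M$ is almost abelian if $M=A+Fy$ where $A\neq 0$ is an abelian ideal, $[a,y]=a$ for all $a\in A$, and either $[y,a]=-a$ for all $a\in A$ (almost abelian Lie algebra; here $M$ is a Lie algebra), or $[y,a]=0$ for all $a\in A$ (almost abelian non-Lie Leibniz algebra); $y$ may be taken with $y^2=[y,y]=0$. *)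

theory Defs
  imports "HOL.Hull" "HOL-Algebra.Module" "HOL-Algebra.QuotRing"
begin

text \<open>
  As in the locale \<^locale>\<open>algebra\<close> of HOL-Algebra, the (here non-associative) product
  $[x,y]$ is the \<open>mult\<close> field of a module record.  The \<open>one\<close> field has no meaning and is
  never used.
\<close>

locale leibniz_algebra = F?: field F + module F L for F and L (structure) +
  assumes bracket_closed [simp, intro]:
      "\<lbrakk>x \<in> carrier L; y \<in> carrier L\<rbrakk> \<Longrightarrow> x \<otimes>\<^bsub>L\<^esub> y \<in> carrier L"
    and bracket_add_left:
      "\<lbrakk>x \<in> carrier L; y \<in> carrier L; z \<in> carrier L\<rbrakk> \<Longrightarrow>
        (x \<oplus>\<^bsub>L\<^esub> y) \<otimes>\<^bsub>L\<^esub> z = x \<otimes>\<^bsub>L\<^esub> z \<oplus>\<^bsub>L\<^esub> y \<otimes>\<^bsub>L\<^esub> z"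
    and bracket_add_right:
      "\<lbrakk>x \<in> carrier L; y \<in> carrier L; z \<in> carrier L\<rbrakk> \<Longrightarrow>
        x \<otimes>\<^bsub>L\<^esub> (y \<oplus>\<^bsub>L\<^esub> z) = x \<otimes>\<^bsub>L\<^esub> y \<oplus>\<^bsub>L\<^esub> x \<otimes>\<^bsub>L\<^esub> z"
    and bracket_smult_left:
      "\<lbrakk>k \<in> carrier F; x \<in> carrier L; y \<in> carrier L\<rbrakk> \<Longrightarrow>
        (k \<odot>\<^bsub>L\<^esub> x) \<otimes>\<^bsub>L\<^esub> y = k \<odot>\<^bsub>L\<^esub> (x \<otimes>\<^bsub>L\<^esub> y)"
    and bracket_smult_right:
      "\<lbrakk>k \<in> carrier F; x \<in> carrier L; y \<in> carrier L\<rbrakk> \<Longrightarrow>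
        x \<otimes>\<^bsub>L\<^esub> (k \<odot>\<^bsub>L\<^esub> y) = k \<odot>\<^bsub>L\<^esub> (x \<otimes>\<^bsub>L\<^esub> y)"
    and leibniz_identity:
      "\<lbrakk>x \<in> carrier L; y \<in> carrier L; z \<in> carrier L\<rbrakk> \<Longrightarrow>
        x \<otimes>\<^bsub>L\<^esub> (y \<otimes>\<^bsub>L\<^esub> z) = (x \<otimes>\<^bsub>L\<^esub> y) \<otimes>\<^bsub>L\<^esub> z \<ominus>\<^bsub>L\<^esub> (x \<otimes>\<^bsub>L\<^esub> z) \<otimes>\<^bsub>L\<^esub> y"

definition lin_span :: "('k, 'm) ring_scheme \<Rightarrow> ('k, 'v, 'n) module_scheme \<Rightarrow> 'v set \<Rightarrow> 'v set"
  where "lin_span F L S = (\<lambda>W. submodule W F L) hull S"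

definition finite_dimensional :: "('k, 'm) ring_scheme \<Rightarrow> ('k, 'v, 'n) module_scheme \<Rightarrow> bool"
  where "finite_dimensional F L \<longleftrightarrow>
    (\<exists>B. finite B \<and> B \<subseteq> carrier L \<and> lin_span F L B = carrier L)"

text \<open>For subspaces $U$, $V$, the symbol $[U,V]$ denotes the subspace spanned by the products.\<close>

definition bracket_space ::
    "('k, 'm) ring_scheme \<Rightarrow> ('k, 'v, 'n) module_scheme \<Rightarrow> 'v set \<Rightarrow> 'v set \<Rightarrow> 'v set"
  where "bracket_space F L U V = lin_span F L {u \<otimes>\<^bsub>L\<^esub> v | u v. u \<in> U \<and> v \<in> V}"

definition leibniz_subalgebra ::
    "'v set \<Rightarrow> ('k, 'm) ring_scheme \<Rightarrow> ('k, 'v, 'n) module_scheme \<Rightarrow> bool"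
  where "leibniz_subalgebra U F L \<longleftrightarrow>
    submodule U F L \<and> (\<forall>x\<in>U. \<forall>y\<in>U. x \<otimes>\<^bsub>L\<^esub> y \<in> U)"

definition leibniz_ideal ::
    "'v set \<Rightarrow> ('k, 'm) ring_scheme \<Rightarrow> ('k, 'v, 'n) module_scheme \<Rightarrow> bool"
  where "leibniz_ideal I F L \<longleftrightarrow>
    submodule I F L \<and> (\<forall>x\<in>I. \<forall>y\<in>carrier L. x \<otimes>\<^bsub>L\<^esub> y \<in> I \<and> y \<otimes>\<^bsub>L\<^esub> x \<in> I)"

definition weak_quasi_ideal ::
    "'v set \<Rightarrow> ('k, 'm) ring_scheme \<Rightarrow> ('k, 'v, 'n) module_scheme \<Rightarrow> bool"
  where "weak_quasi_ideal U F L \<longleftrightarrow>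
    leibniz_subalgebra U F L \<and>
    (\<forall>V. leibniz_subalgebra V F L \<longrightarrow>
      bracket_space F L U V <+>\<^bsub>L\<^esub> bracket_space F L V U \<subseteq> U <+>\<^bsub>L\<^esub> V)"

definition maximal_subalgebra ::
    "'v set \<Rightarrow> ('k, 'm) ring_scheme \<Rightarrow> ('k, 'v, 'n) module_scheme \<Rightarrow> bool"
  where "maximal_subalgebra M F L \<longleftrightarrow>
    leibniz_subalgebra M F L \<and> M \<noteq> carrier L \<and>
    (\<forall>V. leibniz_subalgebra V F L \<and> M \<subseteq> V \<longrightarrow> V = M \<or> V = carrier L)"

text \<open>The zero algebra has no maximal subalgebra; the empty intersection is then the whole algebra.\<close>

definition frattini_subalgebra ::
    "('k, 'm) ring_scheme \<Rightarrow> ('k, 'v, 'n) module_scheme \<Rightarrow> 'v set"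
  where "frattini_subalgebra F L = carrier L \<inter> \<Inter>{M. maximal_subalgebra M F L}"

definition frattini_ideal ::
    "('k, 'm) ring_scheme \<Rightarrow> ('k, 'v, 'n) module_scheme \<Rightarrow> 'v set"
  where "frattini_ideal F L =
    (GREATEST I. leibniz_ideal I F L \<and> I \<subseteq> frattini_subalgebra F L)"

definition quotient_algebra ::
    "('k, 'v, 'n) module_scheme \<Rightarrow> 'v set \<Rightarrow> ('k, 'v set) module"
  where "quotient_algebra L I =
    \<lparr>carrier = a_rcosets\<^bsub>L\<^esub> I, mult = rcoset_mult L I, one = I +>\<^bsub>L\<^esub> \<one>\<^bsub>L\<^esub>,
     zero = I, add = set_add L,
     smult = (\<lambda>k X. \<Union>x\<in>X. I +>\<^bsub>L\<^esub> (k \<odot>\<^bsub>L\<^esub> x))\<rparr>"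

definition abelian_algebra :: "('k, 'm) ring_scheme \<Rightarrow> ('k, 'v, 'n) module_scheme \<Rightarrow> bool"
  where "abelian_algebra F M \<longleftrightarrow>
    leibniz_algebra F M \<and> (\<forall>x\<in>carrier M. \<forall>y\<in>carrier M. x \<otimes>\<^bsub>M\<^esub> y = \<zero>\<^bsub>M\<^esub>)"

text \<open>
  The generator \<open>y\<close> is normalised by $[y,y]=0$.  In the first case below $M$ is then a Lie
  algebra, since $[a+ky,a+ky]=ka-ka=0$.
\<close>

definition almost_abelian :: "('k, 'm) ring_scheme \<Rightarrow> ('k, 'v, 'n) module_scheme \<Rightarrow> bool"
  where "almost_abelian F M \<longleftrightarrow>
    leibniz_algebra F M \<and>
    (\<exists>A y. leibniz_ideal A F M \<and> A \<noteq> {\<zero>\<^bsub>M\<^esub>} \<and>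
      (\<forall>a\<in>A. \<forall>b\<in>A. a \<otimes>\<^bsub>M\<^esub> b = \<zero>\<^bsub>M\<^esub>) \<and>
      y \<in> carrier M \<and> y \<otimes>\<^bsub>M\<^esub> y = \<zero>\<^bsub>M\<^esub> \<and>
      carrier M = A <+>\<^bsub>M\<^esub> {k \<odot>\<^bsub>M\<^esub> y | k. k \<in> carrier F} \<and>
      (\<forall>a\<in>A. a \<otimes>\<^bsub>M\<^esub> y = a) \<and>
      ((\<forall>a\<in>A. y \<otimes>\<^bsub>M\<^esub> a = \<ominus>\<^bsub>M\<^esub> a) \<or> (\<forall>a\<in>A. y \<otimes>\<^bsub>M\<^esub> a = \<zero>\<^bsub>M\<^esub>)))"

end

theory Submission
  imports Defs
begin

text \<open>
  Let $K$ be the ideal of all $x$ with $[L,x]=0$; by the Leibniz identity it contains every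
  square.  If $C$ is a subalgebra minimal with $K+C=L$, then $K\cap C$ is an ideal inside
  $\phi(L)$, so in $Q=L/\phi(L)$ every element has the form $u+c$ with $u\in K(Q)$ and $c^2=0$.
  When $z^2=w^2=0$ in $Q$, the lines $Fz$ and $Fw$ come from subalgebras containing $\phi(L)$,
  and the weak quasi-ideal property yields $[z,w]\in Fz+Fw$.  If all squares in $Q$ vanish, this
  is the classical situation of a Lie algebra in which any two elements span a subalgebra.
  Otherwise some $c$ with $c^2=0$ acts on $K(Q)$ as a nonzero scalar, and comparing
  $[c',y]$ with $[u+c',y]$ for $y$ proportional to $c$ shows $Q=K(Q)+Fy$.
\<close>

text \<open>The obstacle is the nonzero square. The weak quasi-ideal condition controls [x,y] by
  \<open>x\<close> and \<open>y\<close> alone only when the lines through them are subalgebras,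
  which is automatic in a Lie algebra but may fail here when x^2 is nonzero. Since squares lie in K,
  the supplement \<open>C\<close> trades an element for one congruent to it modulo K whose square
  lies in both K and \<open>C\<close>, hence in \<phi>(L). Factoring out \<phi>(L) makes that square
  vanish; this is why the structure appears only in the quotient. Finite dimension enters through
  the existence of a minimal \<open>C\<close>.

  K takes the place of the span of all squares: membership is an equation, and [L,K] = 0 makes K
  abelian at once. If some square is nonzero in the quotient, K is the whole abelian part of the
  almost abelian structure, and [y,K] = 0 selects the non-Lie alternative.\<close>

definition right_annihilator :: "('k, 'v, 'n) module_scheme \<Rightarrow> 'v set"
  where "right_annihilator L = {x \<in> carrier L. \<forall>y\<in>carrier L. y \<otimes>\<^bsub>L\<^esub> x = \<zero>\<^bsub>L\<^esub>}"

context leibniz_algebra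
begin

section \<open>Scalars and brackets\<close>

lemma smult_inverse_cancel:
  assumes "k \<in> carrier F" "k \<noteq> \<zero>\<^bsub>F\<^esub>" "x \<in> carrier L"
  shows "inv\<^bsub>F\<^esub> k \<odot> (k \<odot> x) = x"
  using assms by (simp add: smult_assoc1[symmetric] F.field_Units)

lemma submodule_smult_cancel:
  assumes "submodule W F L" "k \<in> carrier F" "k \<noteq> \<zero>\<^bsub>F\<^esub>" "x \<in> carrier L" "k \<odot> x \<in> W"
  shows "x \<in> W"
  using smult_inverse_cancel[OF assms(2-4)] submoduleE(4)[OF assms(1) _ assms(5), of "inv\<^bsub>F\<^esub> k"]
    assms(2,3) F.field_Units by auto

lemma minus_nonzero:
  assumes "a \<in> carrier F" "b \<in> carrier F" "a \<noteq> b"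
  shows "a \<ominus>\<^bsub>F\<^esub> b \<noteq> \<zero>\<^bsub>F\<^esub>"
  using assms by (auto simp: a_minus_def F.add.inv_solve_right')

lemma smult_minus_left:
  assumes "a \<in> carrier F" "b \<in> carrier F" "x \<in> carrier L"
  shows "(a \<ominus>\<^bsub>F\<^esub> b) \<odot> x = a \<odot> x \<ominus> b \<odot> x"
  using assms by (simp add: a_minus_def smult_l_distr smult_l_minus)

lemma smult_right_cancel:
  assumes "a \<in> carrier F" "b \<in> carrier F" "x \<in> carrier L" "x \<noteq> \<zero>"
    and "a \<odot> x = b \<odot> x"
  shows "a = b"
proof (rule ccontr)
  assume "a \<noteq> b"
  then have ab: "a \<ominus>\<^bsub>F\<^esub> b \<in> carrier F" "a \<ominus>\<^bsub>F\<^esub> b \<noteq> \<zero>\<^bsub>F\<^esub>"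
    using assms(1,2) by (auto dest: minus_nonzero)
  have "(a \<ominus>\<^bsub>F\<^esub> b) \<odot> x = \<zero>"
    using assms by (subst smult_minus_left) (auto simp: a_minus_def M.r_neg)
  then show False
    using smult_inverse_cancel[OF ab assms(3)] assms(4) ab F.field_Units by auto
qed

lemma bracket_zero_left [simp]:
  assumes "x \<in> carrier L" shows "\<zero> \<otimes> x = \<zero>"
  using bracket_smult_left[of "\<zero>\<^bsub>F\<^esub>" "\<zero>" x] assms by simp

lemma bracket_zero_right [simp]:
  assumes "x \<in> carrier L" shows "x \<otimes> \<zero> = \<zero>"
  using bracket_smult_right[of "\<zero>\<^bsub>F\<^esub>" x "\<zero>"] assms by simp

lemma bracket_minus_left:
  assumes "x \<in> carrier L" "y \<in> carrier L"
  shows "(\<ominus> x) \<otimes> y = \<ominus> (x \<otimes> y)"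
  using bracket_add_left[of "\<ominus> x" x y] assms by (simp add: M.l_neg M.minus_equality)

lemma bracket_minus_right:
  assumes "x \<in> carrier L" "y \<in> carrier L"
  shows "x \<otimes> (\<ominus> y) = \<ominus> (x \<otimes> y)"
  using bracket_add_right[of x "\<ominus> y" y] assms by (simp add: M.l_neg M.minus_equality)

lemmas bracket_simps = bracket_add_left bracket_add_right bracket_smult_left bracket_smult_right
  bracket_minus_left bracket_minus_right

lemma minus_eq_minus_of_add_eq:
  assumes "a \<in> carrier L" "b \<in> carrier L" "c \<in> carrier L" "d \<in> carrier L"
    and "a \<oplus> b = c \<oplus> d"
  shows "a \<ominus> c = d \<ominus> b"
proof -
  have "a = (c \<oplus> d) \<ominus> b"
    using assms by (simp add: assms(5)[symmetric] a_minus_def M.a_assoc M.r_neg)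
  then show ?thesis
    using assms(1-4) by (simp add: a_minus_def M.a_comm[of c] M.a_assoc)
      (simp add: M.a_comm[of "\<ominus> b"] M.r_neg2 M.a_assoc[symmetric] M.l_neg)
qed

section \<open>Subspaces, their sums, and lines\<close>

lemma submodule_zero: "submodule W F L \<Longrightarrow> \<zero> \<in> W"
  using submodule.axioms(1) subgroup.one_closed by fastforce

lemma submodule_minus:
  "\<lbrakk>submodule W F L; x \<in> W; y \<in> W\<rbrakk> \<Longrightarrow> x \<ominus> y \<in> W"
  by (simp add: a_minus_def submoduleE)

text \<open>The factor \<open>carrier L\<close> takes care of the empty family, as happens for the
  maximal subalgebras of the zero algebra.\<close>

lemma submodule_Inter:
  assumes "\<And>W. W \<in> \<W> \<Longrightarrow> submodule W F L"
  shows "submodule (carrier L \<inter> \<Inter>\<W>) F L"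
  using assms by (intro submoduleI) (auto simp: submoduleE submodule_zero)

lemma submodule_Int:
  assumes "submodule U F L" "submodule V F L"
  shows "submodule (U \<inter> V) F L"
proof -
  have "U \<inter> V = carrier L \<inter> \<Inter>{U, V}" using submoduleE(1)[OF assms(1)] by auto
  then show ?thesis using submodule_Inter[of "{U, V}"] assms by auto
qed

lemma set_add_iff: "x \<in> U <+>\<^bsub>L\<^esub> V \<longleftrightarrow> (\<exists>u\<in>U. \<exists>v\<in>V. x = u \<oplus> v)"
  by (auto simp: set_add_def')

lemma set_addI: "\<lbrakk>u \<in> U; v \<in> V\<rbrakk> \<Longrightarrow> u \<oplus> v \<in> U <+>\<^bsub>L\<^esub> V"
  by (auto simp: set_add_iff)

lemma submodule_sum:
  assumes U: "submodule U F L" and V: "submodule V F L"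
  shows "submodule (U <+>\<^bsub>L\<^esub> V) F L"
proof (rule submoduleI)
  note c = submoduleE[OF U] submoduleE[OF V]
  have sub: "u \<in> U \<Longrightarrow> u \<in> carrier L" "v \<in> V \<Longrightarrow> v \<in> carrier L" for u v
    using c by auto
  show "U <+>\<^bsub>L\<^esub> V \<subseteq> carrier L"
    using sub by (auto simp: set_add_iff)
  show "\<zero> \<in> U <+>\<^bsub>L\<^esub> V"
    using submodule_zero[OF U] submodule_zero[OF V] sub unfolding set_add_iff by force
  show "\<ominus> a \<in> U <+>\<^bsub>L\<^esub> V" if "a \<in> U <+>\<^bsub>L\<^esub> V" for a
  proof -
    from that obtain u v where uv: "u \<in> U" "v \<in> V" "a = u \<oplus> v"
      by (auto simp: set_add_iff)
    then have "\<ominus> a = \<ominus> u \<oplus> \<ominus> v"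
      using sub by (simp add: M.minus_add)
    then show ?thesis using uv c by (auto intro!: set_addI)
  qed
  show "a \<oplus> b \<in> U <+>\<^bsub>L\<^esub> V" if ab: "a \<in> U <+>\<^bsub>L\<^esub> V" "b \<in> U <+>\<^bsub>L\<^esub> V" for a b
  proof -
    from ab obtain u v u' v' where uv: "u \<in> U" "v \<in> V" "a = u \<oplus> v"
      "u' \<in> U" "v' \<in> V" "b = u' \<oplus> v'"
      by (auto simp: set_add_iff)
    then have "a \<oplus> b = (u \<oplus> u') \<oplus> (v \<oplus> v')"
      using sub by (simp add: M.a_ac)
    then show ?thesis using uv c by (auto intro!: set_addI)
  qed
  show "k \<odot> a \<in> U <+>\<^bsub>L\<^esub> V" if k: "k \<in> carrier F" "a \<in> U <+>\<^bsub>L\<^esub> V" for k a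
  proof -
    from k obtain u v where uv: "u \<in> U" "v \<in> V" "a = u \<oplus> v"
      by (auto simp: set_add_iff)
    then have "k \<odot> a = k \<odot> u \<oplus> k \<odot> v"
      using sub k by (simp add: smult_r_distr)
    then show ?thesis using uv c k by (auto intro!: set_addI)
  qed
qed

lemma line_mem [intro]: "k \<in> carrier F \<Longrightarrow> k \<odot> x \<in> {k \<odot> x | k. k \<in> carrier F}"
  by blast

lemma submodule_line:
  assumes x: "x \<in> carrier L"
  shows "submodule {k \<odot> x | k. k \<in> carrier F} F L" (is "submodule ?W F L")
proof (rule submoduleI)
  show "?W \<subseteq> carrier L" using x by auto
  show "\<zero> \<in> ?W" using line_mem[OF F.zero_closed, of x] x by simp
  show "\<ominus> a \<in> ?W" if "a \<in> ?W" for a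
  proof -
    from that obtain k where "k \<in> carrier F" "a = k \<odot> x" by blast
    then show ?thesis using line_mem[of "\<ominus>\<^bsub>F\<^esub> k" x] x by (simp add: smult_l_minus)
  qed
  show "a \<oplus> b \<in> ?W" if ab: "a \<in> ?W" "b \<in> ?W" for a b
  proof -
    from ab obtain k l where "k \<in> carrier F" "a = k \<odot> x" "l \<in> carrier F" "b = l \<odot> x" by blast
    then show ?thesis using line_mem[of "k \<oplus>\<^bsub>F\<^esub> l" x] x by (simp add: smult_l_distr)
  qed
  show "c \<odot> a \<in> ?W" if c: "c \<in> carrier F" "a \<in> ?W" for c a
  proof -
    from c obtain k where "k \<in> carrier F" "a = k \<odot> x" by blast
    then show ?thesis using c line_mem[of "c \<otimes>\<^bsub>F\<^esub> k" x] x by (simp add: smult_assoc1)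
  qed
qed

lemma set_add_lineE:
  assumes "z \<in> A <+>\<^bsub>L\<^esub> {k \<odot> y | k. k \<in> carrier F}"
  obtains b k where "b \<in> A" "k \<in> carrier F" "z = b \<oplus> k \<odot> y"
  using assms by (auto simp: set_add_def')

lemma submodule_set_add_superset:
  assumes "submodule U F L" "submodule V F L"
  shows "U \<subseteq> U <+>\<^bsub>L\<^esub> V" "V \<subseteq> U <+>\<^bsub>L\<^esub> V"
proof -
  have "u = u \<oplus> \<zero>" if "u \<in> U" for u
    using that submoduleE(1)[OF assms(1)] by auto
  then show "U \<subseteq> U <+>\<^bsub>L\<^esub> V"
    using submodule_zero[OF assms(2)] by (blast intro: set_add_iff[THEN iffD2])
  have "v = \<zero> \<oplus> v" if "v \<in> V" for v
    using that submoduleE(1)[OF assms(2)] by auto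
  then show "V \<subseteq> U <+>\<^bsub>L\<^esub> V"
    using submodule_zero[OF assms(1)] by (blast intro: set_add_iff[THEN iffD2])
qed

section \<open>Spans and a substitute for dimension\<close>

lemma lin_span_submodule:
  assumes "S \<subseteq> carrier L"
  shows "submodule (lin_span F L S) F L"
proof -
  have "lin_span F L S = carrier L \<inter> \<Inter>{W. submodule W F L \<and> S \<subseteq> W}"
    using assms carrier_is_submodule by (auto simp: lin_span_def hull_def)
  then show ?thesis using submodule_Inter[of "{W. submodule W F L \<and> S \<subseteq> W}"] by auto
qed

lemma lin_span_insert_subset:
  assumes "S \<subseteq> carrier L" "b \<in> carrier L"
  shows "lin_span F L (insert b S) \<subseteq> lin_span F L S <+>\<^bsub>L\<^esub> {k \<odot> b | k. k \<in> carrier F}"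
proof -
  let ?l = "{k \<odot> b | k. k \<in> carrier F}"
  have s: "submodule (lin_span F L S) F L" "submodule ?l F L"
    using lin_span_submodule[OF assms(1)] submodule_line[OF assms(2)] by auto
  have "b = \<one>\<^bsub>F\<^esub> \<odot> b" using assms by simp
  then have "b \<in> ?l" by blast
  moreover have "S \<subseteq> lin_span F L S" by (auto simp: lin_span_def hull_inc)
  ultimately show ?thesis
    unfolding lin_span_def[of F L "insert b S"]
    by (intro hull_minimal) (use submodule_set_add_superset[OF s] submodule_sum[OF s] in auto)
qed

text \<open>The function \<open>d\<close> stands in for the dimension; strict monotonicity is all
  that the choice of a minimal subalgebra requires. It counts the steps of the flag built from the
  spanning set at which a subspace grows, so no basis has to be extracted.\<close>

lemma submodule_rank_span:
  assumes "finite B" "B \<subseteq> carrier L"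
  shows "\<exists>d :: 'c set \<Rightarrow> nat. \<forall>W W'. submodule W F L \<and> submodule W' F L \<and> W \<subset> W' \<and>
           W' \<subseteq> lin_span F L B \<longrightarrow> d W < d W'"
  using assms
proof (induction B rule: finite_induct)
  case empty
  have "submodule {\<zero>} F L" by (rule submoduleI) auto
  then have "lin_span F L {} \<subseteq> {\<zero>}"
    unfolding lin_span_def by (intro hull_minimal) auto
  then have "\<not> W \<subset> W'" if "submodule W F L" "W' \<subseteq> lin_span F L {}" for W W'
    using submodule_zero[OF that(1)] that(2) by auto
  then show ?case by meson
next
  case (insert b B)
  let ?V = "lin_span F L B"
  have B: "B \<subseteq> carrier L" "b \<in> carrier L" using insert by auto
  obtain d :: "'c set \<Rightarrow> nat" where
    d0: "\<forall>W W'. submodule W F L \<and> submodule W' F L \<and> W \<subset> W' \<and> W' \<subseteq> ?V \<longrightarrow> d W < d W'"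
    using insert.IH[OF B(1)] by (elim exE)
  have d: "d W < d W'" if "submodule W F L" "submodule W' F L" "W \<subset> W'" "W' \<subseteq> ?V" for W W'
    using d0 that by simp
  have V: "submodule ?V F L" using lin_span_submodule[OF B(1)] .
  \<comment> \<open>Adding \<open>b\<close> raises the dimension of the span by at most one, so a
    single extra unit records whether \<open>W\<close> leaves \<open>?V\<close>.\<close>
  define d' where "d' W = d (W \<inter> ?V) + (if W \<subseteq> ?V then 0 else 1)" for W
  have "d' W < d' W'"
    if W: "submodule W F L" and W': "submodule W' F L" and lt: "W \<subset> W'"
      and le: "W' \<subseteq> lin_span F L (insert b B)" for W W'
  proof (cases "W \<inter> ?V = W' \<inter> ?V")
    case False
    then have "d (W \<inter> ?V) < d (W' \<inter> ?V)"
      using lt by (intro d submodule_Int V W W') auto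
    then show ?thesis using lt by (auto simp: d'_def)
  next
    case True
    \<comment> \<open>With equal traces on \<open>?V\<close>, a vector \<open>w\<close> of
      \<open>W\<close> outside \<open>?V\<close> has a nonzero coefficient at \<open>b\<close> and
      can be used to eliminate \<open>b\<close> from any \<open>x\<close> in \<open>W'\<close>. The
      result lies in the common trace, which puts \<open>x\<close> into \<open>W\<close> and
      contradicts strict inclusion.\<close>
    have "W \<subseteq> ?V"
    proof (rule ccontr)
      assume "\<not> W \<subseteq> ?V"
      then obtain w where w: "w \<in> W" "w \<notin> ?V" by auto
      have "x \<in> W" if x: "x \<in> W'" for x
      proof -
        have dec: "\<exists>v\<in>?V. \<exists>k\<in>carrier F. z = v \<oplus> k \<odot> b" if "z \<in> W'" for z
        proof -
          have "z \<in> ?V <+>\<^bsub>L\<^esub> {k \<odot> b | k. k \<in> carrier F}"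
            using that le lin_span_insert_subset[OF B] by blast
          then show ?thesis unfolding set_add_iff by blast
        qed
        obtain v k where v: "v \<in> ?V" "k \<in> carrier F" "w = v \<oplus> k \<odot> b"
          using dec w lt by blast
        obtain v' k' where v': "v' \<in> ?V" "k' \<in> carrier F" "x = v' \<oplus> k' \<odot> b"
          using dec x by blast
        have vc: "v \<in> carrier L" "v' \<in> carrier L" "w \<in> carrier L" "x \<in> carrier L"
          using v v' submoduleE(1)[OF V] submoduleE(1)[OF W'] x w lt by auto
        have k0: "k \<noteq> \<zero>\<^bsub>F\<^esub>" using v w vc B by auto
        let ?x = "k \<odot> x \<ominus> k' \<odot> w"
        have "?x = k \<odot> v' \<ominus> k' \<odot> v"
        proof -
          have "k \<otimes>\<^bsub>F\<^esub> k' = k' \<otimes>\<^bsub>F\<^esub> k" using v v' F.m_comm by auto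
          then have "k \<odot> (k' \<odot> b) = k' \<odot> (k \<odot> b)"
            using v v' B by (simp add: smult_assoc1[symmetric])
          then show ?thesis
            using v(2,3) v'(2,3) vc B
            by (simp add: a_minus_def smult_r_distr M.minus_add M.a_ac M.r_neg M.r_neg1 M.r_neg2)
        qed
        also have "\<dots> \<in> ?V"
          using v v' submoduleE(4)[OF V] by (intro submodule_minus[OF V]) auto
        finally have "?x \<in> ?V" .
        moreover have "?x \<in> W'"
          using x w lt v v' submoduleE(4)[OF W'] by (intro submodule_minus[OF W']) auto
        ultimately have "?x \<in> W" using True by auto
        then have "?x \<oplus> k' \<odot> w \<in> W"
          using submoduleE(4,5)[OF W] w v' by auto
        moreover have "?x \<oplus> k' \<odot> w = k \<odot> x"
          using v(2) v'(2) vc by (simp add: a_minus_def M.a_assoc M.l_neg)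
        ultimately show ?thesis
          using submodule_smult_cancel[OF W v(2) k0 vc(4)] by simp
      qed
      then show False using lt by auto
    qed
    then have "\<not> W' \<subseteq> ?V" using True lt by auto
    then show ?thesis using True \<open>W \<subseteq> ?V\<close> by (auto simp: d'_def)
  qed
  then show ?case by (intro exI[of _ d'] allI impI) simp
qed

lemma finite_dimensional_rank:
  assumes "finite_dimensional F L"
  obtains d :: "'c set \<Rightarrow> nat" where
    "\<And>W W'. \<lbrakk>submodule W F L; submodule W' F L; W \<subset> W'\<rbrakk> \<Longrightarrow> d W < d W'"
proof -
  obtain B where B: "finite B" "B \<subseteq> carrier L" "lin_span F L B = carrier L"
    using assms by (auto simp: finite_dimensional_def)
  obtain d :: "'c set \<Rightarrow> nat" where
    d: "\<forall>W W'. submodule W F L \<and> submodule W' F L \<and> W \<subset> W' \<and> W' \<subseteq> carrier L \<longrightarrow> d W < d W'"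
    using submodule_rank_span[OF B(1,2)] unfolding B(3) by (elim exE)
  show thesis using d submoduleE(1) by (intro that[of d]) simp
qed

section \<open>Ideals, subalgebras and the Frattini ideal\<close>

lemma leibniz_idealD:
  assumes "leibniz_ideal I F L"
  shows "submodule I F L" "I \<subseteq> carrier L"
    and "\<lbrakk>x \<in> I; y \<in> carrier L\<rbrakk> \<Longrightarrow> x \<otimes> y \<in> I"
    and "\<lbrakk>x \<in> I; y \<in> carrier L\<rbrakk> \<Longrightarrow> y \<otimes> x \<in> I"
  using assms by (auto simp: leibniz_ideal_def dest: submoduleE(1))

lemma leibniz_subalgebraD:
  assumes "leibniz_subalgebra U F L"
  shows "submodule U F L" "U \<subseteq> carrier L"
    and "\<lbrakk>x \<in> U; y \<in> U\<rbrakk> \<Longrightarrow> x \<otimes> y \<in> U"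
  using assms by (auto simp: leibniz_subalgebra_def dest: submoduleE(1))

lemma leibniz_subalgebra_carrier: "leibniz_subalgebra (carrier L) F L"
  by (simp add: leibniz_subalgebra_def carrier_is_submodule)

lemma leibniz_subalgebra_Int:
  assumes "leibniz_subalgebra U F L" "leibniz_subalgebra V F L"
  shows "leibniz_subalgebra (U \<inter> V) F L"
  using assms by (simp add: leibniz_subalgebra_def submodule_Int)

lemma leibniz_ideal_sum:
  assumes I: "leibniz_ideal I F L" and J: "leibniz_ideal J F L"
  shows "leibniz_ideal (I <+>\<^bsub>L\<^esub> J) F L"
  unfolding leibniz_ideal_def
proof (intro conjI ballI)
  show "submodule (I <+>\<^bsub>L\<^esub> J) F L"
    using submodule_sum leibniz_idealD(1) I J by blast
  fix x y assume "x \<in> I <+>\<^bsub>L\<^esub> J" and y: "y \<in> carrier L"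
  then obtain i j where ij: "i \<in> I" "j \<in> J" "x = i \<oplus> j" by (auto simp: set_add_iff)
  moreover from ij have "i \<in> carrier L" "j \<in> carrier L"
    using leibniz_idealD(2) I J by auto
  ultimately show "x \<otimes> y \<in> I <+>\<^bsub>L\<^esub> J" "y \<otimes> x \<in> I <+>\<^bsub>L\<^esub> J"
    using y leibniz_idealD(3,4)[OF I] leibniz_idealD(3,4)[OF J]
    by (auto simp: bracket_simps intro!: set_addI)
qed

lemma leibniz_subalgebra_sum_ideal:
  assumes I: "leibniz_ideal I F L" and U: "leibniz_subalgebra U F L"
  shows "leibniz_subalgebra (I <+>\<^bsub>L\<^esub> U) F L"
  unfolding leibniz_subalgebra_def
proof (intro conjI ballI)
  show "submodule (I <+>\<^bsub>L\<^esub> U) F L"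
    using submodule_sum leibniz_idealD(1)[OF I] leibniz_subalgebraD(1)[OF U] by blast
  fix x y assume "x \<in> I <+>\<^bsub>L\<^esub> U" "y \<in> I <+>\<^bsub>L\<^esub> U"
  then obtain i u j v where *: "i \<in> I" "u \<in> U" "x = i \<oplus> u" "j \<in> I" "v \<in> U" "y = j \<oplus> v"
    by (auto simp: set_add_iff)
  moreover from * have c: "i \<in> carrier L" "j \<in> carrier L" "u \<in> carrier L" "v \<in> carrier L"
    using leibniz_idealD(2)[OF I] leibniz_subalgebraD(2)[OF U] by auto
  ultimately have "x \<otimes> y = (i \<otimes> j \<oplus> i \<otimes> v \<oplus> u \<otimes> j) \<oplus> u \<otimes> v"
    by (simp add: bracket_simps M.a_ac)
  moreover have "i \<otimes> j \<oplus> i \<otimes> v \<oplus> u \<otimes> j \<in> I"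
    using * c leibniz_idealD(3,4)[OF I] submoduleE(5)[OF leibniz_idealD(1)[OF I]] by auto
  moreover have "u \<otimes> v \<in> U" using * leibniz_subalgebraD(3)[OF U] by auto
  ultimately show "x \<otimes> y \<in> I <+>\<^bsub>L\<^esub> U" by (auto simp: set_add_iff)
qed

lemma frattini_subalgebra_submodule: "submodule (frattini_subalgebra F L) F L"
  unfolding frattini_subalgebra_def
  by (rule submodule_Inter) (auto simp: maximal_subalgebra_def leibniz_subalgebra_def)

text \<open>\<open>GREATEST\<close> is meaningful only once a greatest element is known to exist.
  The ideals inside the Frattini subalgebra include zero and are closed under sums, so their union
  is again a subspace, hence the largest of them.\<close>

lemma frattini_ideal_greatest:
  shows "leibniz_ideal (frattini_ideal F L) F L"
    and "\<lbrakk>leibniz_ideal J F L; J \<subseteq> frattini_subalgebra F L\<rbrakk> \<Longrightarrow> J \<subseteq> frattini_ideal F L"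
proof -
  let ?S = "frattini_subalgebra F L"
  let ?P = "\<lambda>I. leibniz_ideal I F L \<and> I \<subseteq> ?S"
  define G where "G = \<Union>{I. ?P I}"
  note S = frattini_subalgebra_submodule
  have zero: "?P {\<zero>}"
    using submodule_zero[OF S] by (auto simp: leibniz_ideal_def intro!: submoduleI)
  have sum: "?P (I <+>\<^bsub>L\<^esub> J)" if "?P I" "?P J" for I J
    using that leibniz_ideal_sum submoduleE(5)[OF S] unfolding set_add_def' by blast
  have G: "leibniz_ideal G F L"
    unfolding leibniz_ideal_def
  proof (intro conjI ballI)
    show "submodule G F L"
    proof (rule submoduleI)
      show "G \<subseteq> carrier L" using leibniz_idealD(2) unfolding G_def by blast
      show "\<zero> \<in> G" using zero unfolding G_def by blast
      show "\<ominus> x \<in> G" if "x \<in> G" for x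
        using that leibniz_idealD(1) submoduleE(3) unfolding G_def by blast
      show "k \<odot> x \<in> G" if "k \<in> carrier F" "x \<in> G" for k x
        using that leibniz_idealD(1) submoduleE(4) unfolding G_def by blast
      show "x \<oplus> y \<in> G" if xy: "x \<in> G" "y \<in> G" for x y
      proof -
        obtain I J where "?P I" "x \<in> I" "?P J" "y \<in> J" using xy unfolding G_def by blast
        then have "x \<oplus> y \<in> I <+>\<^bsub>L\<^esub> J" "?P (I <+>\<^bsub>L\<^esub> J)"
          using sum by (auto simp: set_add_iff)
        then show ?thesis unfolding G_def by blast
      qed
    qed
    fix x y assume "x \<in> G" and y: "y \<in> carrier L"
    then obtain J where J: "?P J" "x \<in> J" unfolding G_def by blast
    then have "x \<otimes> y \<in> J" "y \<otimes> x \<in> J" using y leibniz_idealD(3,4) by auto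
    then show "x \<otimes> y \<in> G" "y \<otimes> x \<in> G" using J unfolding G_def by blast+
  qed
  have "frattini_ideal F L = G"
    unfolding frattini_ideal_def by (rule Greatest_equality) (use G in \<open>auto simp: G_def\<close>)
  then show "leibniz_ideal (frattini_ideal F L) F L"
    and "\<lbrakk>leibniz_ideal J F L; J \<subseteq> ?S\<rbrakk> \<Longrightarrow> J \<subseteq> frattini_ideal F L"
    using G by (auto simp: G_def)
qed

section \<open>The right annihilator and its supplement\<close>

lemma right_annihilatorD:
  assumes "x \<in> right_annihilator L"
  shows "x \<in> carrier L" "y \<in> carrier L \<Longrightarrow> y \<otimes> x = \<zero>"
  using assms by (auto simp: right_annihilator_def)

lemma right_annihilator_submodule: "submodule (right_annihilator L) F L"
  by (rule submoduleI) (auto simp: right_annihilator_def bracket_simps)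

text \<open>For \<open>x\<close> in the annihilator both terms of [w,[x,y]] = [[w,x],y] - [[w,y],x]
  vanish, and [y,x] is itself zero.\<close>

lemma right_annihilator_ideal: "leibniz_ideal (right_annihilator L) F L"
  unfolding leibniz_ideal_def
proof (intro conjI ballI right_annihilator_submodule)
  fix x y assume x: "x \<in> right_annihilator L" and y: "y \<in> carrier L"
  note xc = right_annihilatorD[OF x]
  show "x \<otimes> y \<in> right_annihilator L"
    using xc y by (auto simp: right_annihilator_def leibniz_identity a_minus_def)
  show "y \<otimes> x \<in> right_annihilator L"
    using xc y by (auto simp: right_annihilator_def)
qed

lemma square_in_right_annihilator:
  assumes "x \<in> carrier L"
  shows "x \<otimes> x \<in> right_annihilator L"
  using assms by (auto simp: right_annihilator_def leibniz_identity a_minus_def M.r_neg)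

lemma weak_quasi_ideal_bracket:
  assumes "weak_quasi_ideal U F L" "leibniz_subalgebra V F L" "u \<in> U" "v \<in> V"
  shows "u \<otimes> v \<in> U <+>\<^bsub>L\<^esub> V"
proof -
  have "u \<in> carrier L" "v \<in> carrier L"
    using assms by (auto simp: weak_quasi_ideal_def dest!: leibniz_subalgebraD(2))
  moreover have "u \<otimes> v \<in> bracket_space F L U V"
    unfolding bracket_space_def lin_span_def using assms(3,4) by (intro hull_inc) blast
  moreover have "\<zero> \<in> bracket_space F L V U"
    by (auto simp: bracket_space_def lin_span_def hull_def submodule_zero)
  ultimately have "u \<otimes> v \<in> bracket_space F L U V <+>\<^bsub>L\<^esub> bracket_space F L V U"
    unfolding set_add_iff by (metis M.r_zero bracket_closed)
  then show ?thesis using assms(1,2) by (auto simp: weak_quasi_ideal_def)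
qed

text \<open>
  A subalgebra \<open>C\<close> minimal with $K + C = L$ will do, as an ideal not contained in a maximal
  subalgebra \<open>M\<close> would allow \<open>C\<close> to be replaced by $M \cap C$.
\<close>

lemma right_annihilator_supplement:
  assumes "finite_dimensional F L"
  obtains C where "leibniz_subalgebra C F L" "right_annihilator L <+>\<^bsub>L\<^esub> C = carrier L"
    "right_annihilator L \<inter> C \<subseteq> frattini_ideal F L"
proof -
  let ?K = "right_annihilator L"
  let ?P = "\<lambda>C. leibniz_subalgebra C F L \<and> ?K <+>\<^bsub>L\<^esub> C = carrier L"
  note K = right_annihilator_submodule
  obtain d :: "'c set \<Rightarrow> nat" where
    d: "\<And>W W'. \<lbrakk>submodule W F L; submodule W' F L; W \<subset> W'\<rbrakk> \<Longrightarrow> d W < d W'"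
    using finite_dimensional_rank[OF assms] by blast
  have "?P (carrier L)"
    using leibniz_subalgebra_carrier submodule_set_add_superset(2)[OF K carrier_is_submodule]
      submoduleE(1)[OF submodule_sum[OF K carrier_is_submodule]] by blast
  \<comment> \<open>Least rank implies minimality under inclusion because \<open>d\<close> is
    strictly monotone.\<close>
  from ex_has_least_nat[of ?P, OF this, of d] obtain C where
    C: "leibniz_subalgebra C F L" "?K <+>\<^bsub>L\<^esub> C = carrier L" and least: "\<And>D. ?P D \<Longrightarrow> d C \<le> d D"
    by blast
  note Cs = leibniz_subalgebraD[OF C(1)]
  have J: "leibniz_ideal (?K \<inter> C) F L"
    unfolding leibniz_ideal_def
  proof (intro conjI ballI)
    show "submodule (?K \<inter> C) F L" using submodule_Int K Cs by blast
    fix x y assume x: "x \<in> ?K \<inter> C" and y: "y \<in> carrier L"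
    have xy: "y \<otimes> x = \<zero>" "x \<in> carrier L" using x y right_annihilatorD by auto
    then show "y \<otimes> x \<in> ?K \<inter> C" using submodule_zero K Cs by auto
    \<comment> \<open>Right multiplication of \<open>x\<close> by \<open>y\<close> sees only the
      \<open>C\<close>-part of \<open>y\<close>, since [x,u] = 0. So the intersection is an ideal of
      the whole algebra although \<open>C\<close> is merely a subalgebra.\<close>
    obtain u c where u: "u \<in> ?K" "c \<in> C" "y = u \<oplus> c"
      using y C(2) by (metis set_add_iff)
    then have c: "x \<otimes> y = x \<otimes> c" "c \<in> carrier L"
      using xy right_annihilatorD[OF u(1)] Cs(2) by (auto simp: bracket_simps)
    then show "x \<otimes> y \<in> ?K \<inter> C"
      using x u Cs(3) leibniz_idealD(3)[OF right_annihilator_ideal] by auto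
  qed
  have "?K \<inter> C \<subseteq> M" if M: "maximal_subalgebra M F L" for M
  proof (rule ccontr)
    assume nsub: "\<not> ?K \<inter> C \<subseteq> M"
    have Ms: "leibniz_subalgebra M F L" using M by (simp add: maximal_subalgebra_def)
    let ?V = "(?K \<inter> C) <+>\<^bsub>L\<^esub> M"
    have V: "leibniz_subalgebra ?V F L" using leibniz_subalgebra_sum_ideal[OF J Ms] .
    have sup: "?K \<inter> C \<subseteq> ?V" "M \<subseteq> ?V"
      using submodule_set_add_superset[OF leibniz_idealD(1)[OF J] leibniz_subalgebraD(1)[OF Ms]]
      by auto
    then have eq: "?V = carrier L" using M V nsub unfolding maximal_subalgebra_def by blast
    have MC: "leibniz_subalgebra (M \<inter> C) F L" using leibniz_subalgebra_Int Ms C by blast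
    \<comment> \<open>Dedekind's modular law: from (K \<inter> C) + M = L each \<open>c\<close> in
      \<open>C\<close> splits as \<open>j + m\<close>, and m = c - j stays in \<open>C\<close>. The
      part \<open>j\<close> is absorbed by K.\<close>
    have "x \<in> ?K <+>\<^bsub>L\<^esub> (M \<inter> C)" if x: "x \<in> carrier L" for x
    proof -
      obtain u c where u: "u \<in> ?K" "c \<in> C" "x = u \<oplus> c"
        using x C(2) by (metis set_add_iff)
      moreover from u have "c \<in> carrier L" using Cs by auto
      then obtain j m where j: "j \<in> ?K \<inter> C" "m \<in> M" "c = j \<oplus> m"
        using eq by (metis set_add_iff)
      moreover have cc: "u \<in> carrier L" "j \<in> carrier L" "m \<in> carrier L"
        using u j right_annihilatorD(1) leibniz_subalgebraD(2)[OF Ms] by auto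
      ultimately have "x = (u \<oplus> j) \<oplus> m" by (simp add: M.a_ac)
      moreover have "m = c \<ominus> j"
        using j cc by (simp add: a_minus_def M.a_comm[of j m] M.a_assoc M.r_neg)
      then have "m \<in> M \<inter> C" using j u submodule_minus[OF Cs(1), of c j] by (metis IntD2 IntI)
      moreover have "u \<oplus> j \<in> ?K" using u j submoduleE(5)[OF K] by auto
      ultimately show ?thesis unfolding set_add_iff by blast
    qed
    then have "?K <+>\<^bsub>L\<^esub> (M \<inter> C) = carrier L"
      using submoduleE(1)[OF submodule_sum[OF K leibniz_subalgebraD(1)[OF MC]]] by blast
    then have "d C \<le> d (M \<inter> C)" using least MC by blast
    moreover have "M \<inter> C \<subset> C" using nsub by blast
    ultimately show False
      using d[OF leibniz_subalgebraD(1)[OF MC] Cs(1)] by auto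
  qed
  then have "?K \<inter> C \<subseteq> frattini_subalgebra F L"
    using Cs(2) by (auto simp: frattini_subalgebra_def)
  then show thesis using that C frattini_ideal_greatest(2)[OF J] by blast
qed

text \<open>Let a, b, c be eigenvalues for v, w and v + w. Additivity gives (a - c) v = (c - b) w,
  so either all three agree or \<open>w\<close> is a multiple of \<open>v\<close>. The map of
  interest is right multiplication by a square-zero element on the annihilator.\<close>

lemma scalar_of_eigenvectors:
  assumes K: "submodule K F L"
    and closed: "\<And>w. w \<in> K \<Longrightarrow> T w \<in> carrier L"
    and add: "\<And>v w. \<lbrakk>v \<in> K; w \<in> K\<rbrakk> \<Longrightarrow> T (v \<oplus> w) = T v \<oplus> T w"
    and smult: "\<And>k w. \<lbrakk>k \<in> carrier F; w \<in> K\<rbrakk> \<Longrightarrow> T (k \<odot> w) = k \<odot> T w"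
    and eig: "\<And>w. w \<in> K \<Longrightarrow> \<exists>a\<in>carrier F. T w = a \<odot> w"
  shows "\<exists>a\<in>carrier F. \<forall>w\<in>K. T w = a \<odot> w"
proof (cases "K = {\<zero>}")
  case True
  then show ?thesis using eig by auto
next
  case False
  then obtain v where v: "v \<in> K" "v \<noteq> \<zero>" using submodule_zero[OF K] by auto
  obtain a where a: "a \<in> carrier F" "T v = a \<odot> v" using eig v by blast
  have "T w = a \<odot> w" if w: "w \<in> K" for w
  proof -
    obtain b where b: "b \<in> carrier F" "T w = b \<odot> w" using eig w by blast
    obtain c where c: "c \<in> carrier F" "T (v \<oplus> w) = c \<odot> (v \<oplus> w)"
      using eig submoduleE(5)[OF K] v w by blast
    have vw: "v \<in> carrier L" "w \<in> carrier L" using submoduleE(1)[OF K] v w by auto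
    have sum: "a \<odot> v \<oplus> b \<odot> w = c \<odot> v \<oplus> c \<odot> w"
      using add[OF v(1) w] a b c vw by (simp add: smult_r_distr)
    have rel: "(a \<ominus>\<^bsub>F\<^esub> c) \<odot> v = (c \<ominus>\<^bsub>F\<^esub> b) \<odot> w"
      using sum a b c vw minus_eq_minus_of_add_eq[of "a \<odot> v" "b \<odot> w" "c \<odot> v" "c \<odot> w"]
      by (simp add: smult_minus_left)
    show ?thesis
    proof (cases "c = b")
      case True
      then have "a \<odot> v = c \<odot> v" using sum a b c vw by simp
      then show ?thesis using smult_right_cancel[OF a(1) c(1) vw(1) v(2)] True b by simp
    next
      case False
      then have cb: "c \<ominus>\<^bsub>F\<^esub> b \<in> carrier F" "c \<ominus>\<^bsub>F\<^esub> b \<noteq> \<zero>\<^bsub>F\<^esub>"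
        using b c minus_nonzero by auto
      have "(c \<ominus>\<^bsub>F\<^esub> b) \<odot> w \<in> {k \<odot> v | k. k \<in> carrier F}"
        using line_mem[of "a \<ominus>\<^bsub>F\<^esub> c" v] rel a c by simp
      then have "w \<in> {k \<odot> v | k. k \<in> carrier F}"
        by (rule submodule_smult_cancel[OF submodule_line[OF vw(1)] cb vw(2)])
      then obtain k where k: "k \<in> carrier F" "w = k \<odot> v" by blast
      then have "T w = k \<odot> (a \<odot> v)" using smult a v by simp
      also have "\<dots> = a \<odot> w" using k a vw by (simp add: smult_assoc1[symmetric] F.m_comm)
      finally show ?thesis .
    qed
  qed
  then show ?thesis using a by blast
qed

end

section \<open>The quotient by an ideal\<close>

lemma quotient_algebra_sel:
  "carrier (quotient_algebra L I) = (\<lambda>x. I +>\<^bsub>L\<^esub> x) ` carrier L"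
  "zero (quotient_algebra L I) = I"
  "add (quotient_algebra L I) = set_add L"
  "mult (quotient_algebra L I) = rcoset_mult L I"
  "smult (quotient_algebra L I) = (\<lambda>k X. \<Union>x\<in>X. I +>\<^bsub>L\<^esub> (k \<odot>\<^bsub>L\<^esub> x))"
  by (auto simp: quotient_algebra_def A_RCOSETS_def')

locale leibniz_quotient = leibniz_algebra +
  fixes I
  assumes ideal: "leibniz_ideal I F L"
begin

abbreviation "Q \<equiv> quotient_algebra L I"
abbreviation "proj \<equiv> \<lambda>x. I +>\<^bsub>L\<^esub> x"

lemma I_submodule: "submodule I F L" and I_subset: "I \<subseteq> carrier L"
  using leibniz_idealD(1,2)[OF ideal] .

sublocale I: abelian_subgroup I L
  using I_submodule submodule.axioms(1) M.abelian_group_axioms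
  by (intro abelian_subgroupI3 additive_subgroupI)

lemma proj_self: "x \<in> carrier L \<Longrightarrow> x \<in> proj x"
  by (rule I.a_rcos_self)

lemma proj_elem:
  assumes "x \<in> carrier L" "y \<in> proj x"
  obtains i where "i \<in> I" "i \<in> carrier L" "y = i \<oplus> x"
  using assms I_subset by (auto simp: a_r_coset_def')

lemma proj_add_left:
  assumes "x \<in> carrier L" "i \<in> I"
  shows "proj (i \<oplus> x) = proj x"
proof -
  have "i \<oplus> x \<in> proj x" using assms by (auto simp: a_r_coset_def')
  then show ?thesis using assms M.a_repr_independence I.a_subgroup by metis
qed

lemma proj_zero: "i \<in> I \<Longrightarrow> proj i = I"
  using M.a_coset_join2 I_subset I.a_subgroup by blast

lemma proj_eq_I_iff: "x \<in> carrier L \<Longrightarrow> proj x = I \<longleftrightarrow> x \<in> I"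
  using proj_zero proj_self by blast

lemma proj_add: "\<lbrakk>x \<in> carrier L; y \<in> carrier L\<rbrakk> \<Longrightarrow> proj x \<oplus>\<^bsub>Q\<^esub> proj y = proj (x \<oplus> y)"
  by (simp add: quotient_algebra_sel I.a_rcos_sum)

text \<open>The product of two cosets is encoded as a union over representatives. Every member of
  that union is the same coset because \<open>I\<close> is a two-sided ideal, and the union
  collapses because cosets are nonempty.\<close>

lemma proj_mult:
  assumes x: "x \<in> carrier L" and y: "y \<in> carrier L"
  shows "proj x \<otimes>\<^bsub>Q\<^esub> proj y = proj (x \<otimes> y)"
proof -
  have "proj (a \<otimes> b) = proj (x \<otimes> y)" if a: "a \<in> proj x" and b: "b \<in> proj y" for a b
  proof -
    obtain i j where i: "i \<in> I" "i \<in> carrier L" "a = i \<oplus> x"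
      and j: "j \<in> I" "j \<in> carrier L" "b = j \<oplus> y"
      using proj_elem[OF x a] proj_elem[OF y b] by metis
    have "a \<otimes> b = (i \<otimes> j \<oplus> i \<otimes> y \<oplus> x \<otimes> j) \<oplus> x \<otimes> y"
      using i j x y by (simp add: bracket_simps M.a_ac)
    moreover have "i \<otimes> j \<oplus> i \<otimes> y \<oplus> x \<otimes> j \<in> I"
      using i j x y leibniz_idealD(3,4)[OF ideal] by auto
    ultimately show ?thesis using proj_add_left x y by simp
  qed
  then have "(\<Union>a\<in>proj x. \<Union>b\<in>proj y. proj (a \<otimes> b)) = (\<Union>a\<in>proj x. \<Union>b\<in>proj y. proj (x \<otimes> y))"
    by (intro SUP_cong refl)
  also have "\<dots> = proj (x \<otimes> y)" using proj_self[OF x] proj_self[OF y] by (simp only: UN_constant) auto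
  finally show ?thesis by (simp only: quotient_algebra_sel rcoset_mult_def)
qed

lemma proj_smult:
  assumes k: "k \<in> carrier F" and x: "x \<in> carrier L"
  shows "k \<odot>\<^bsub>Q\<^esub> proj x = proj (k \<odot> x)"
proof -
  have "proj (k \<odot> a) = proj (k \<odot> x)" if a: "a \<in> proj x" for a
  proof -
    obtain i where i: "i \<in> I" "i \<in> carrier L" "a = i \<oplus> x" using proj_elem[OF x a] .
    then show ?thesis
      using k x proj_add_left[of "k \<odot> x" "k \<odot> i"] submoduleE(4)[OF I_submodule]
      by (simp add: smult_r_distr)
  qed
  then have "(\<Union>a\<in>proj x. proj (k \<odot> a)) = (\<Union>a\<in>proj x. proj (k \<odot> x))"
    by (intro SUP_cong refl)
  also have "\<dots> = proj (k \<odot> x)" using proj_self[OF x] by (simp only: UN_constant) auto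
  finally show ?thesis by (simp only: quotient_algebra_sel)
qed

lemma Q_carrierE:
  assumes "X \<in> carrier Q"
  obtains x where "x \<in> carrier L" "X = proj x"
  using assms by (auto simp: quotient_algebra_sel)

lemma proj_closed: "x \<in> carrier L \<Longrightarrow> proj x \<in> carrier Q"
  by (simp add: quotient_algebra_sel)

lemma quotient_zero: "\<zero>\<^bsub>Q\<^esub> = proj \<zero>"
  using proj_zero[OF I.zero_closed] by (simp add: quotient_algebra_sel)

lemmas proj_simps = proj_add proj_mult proj_smult proj_closed

lemma leibniz_algebra_quotient: "leibniz_algebra F Q"
proof -
  interpret Q: abelian_group Q
  proof (rule abelian_groupI)
    show "\<zero>\<^bsub>Q\<^esub> \<in> carrier Q" by (simp add: quotient_zero proj_closed)
    show "\<exists>Y\<in>carrier Q. Y \<oplus>\<^bsub>Q\<^esub> X = \<zero>\<^bsub>Q\<^esub>" if X: "X \<in> carrier Q" for X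
    proof -
      obtain x where "x \<in> carrier L" "X = proj x" using X by (rule Q_carrierE)
      then show ?thesis
        by (intro bexI[of _ "proj (\<ominus> x)"]) (simp_all add: proj_simps M.l_neg quotient_zero)
    qed
  qed (auto elim!: Q_carrierE simp: proj_simps quotient_zero M.a_ac)
  interpret Q: module F Q
    by (rule moduleI)
      (auto elim!: Q_carrierE simp: proj_simps smult_l_distr smult_r_distr smult_assoc1
        intro: F.is_cring Q.abelian_group_axioms)
  have minus: "\<ominus>\<^bsub>Q\<^esub> proj x = proj (\<ominus> x)" if "x \<in> carrier L" for x
    using that by (intro Q.minus_equality) (simp_all add: proj_simps M.l_neg quotient_zero)
  show ?thesis
    by unfold_locales
      (auto elim!: Q_carrierE simp: proj_simps bracket_simps leibniz_identity a_minus_def minus)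
qed

text \<open>This is the preimage of the line through a square-zero coset. Each term of a product of
  two such elements, including the multiple of [x,x], already falls into \<open>I\<close>. Through
  these preimages a hypothesis on subalgebras of \<open>L\<close> reaches lines of the
  quotient.\<close>

lemma leibniz_subalgebra_ideal_line:
  assumes x: "x \<in> carrier L" and sq: "x \<otimes> x \<in> I"
  shows "leibniz_subalgebra (I <+>\<^bsub>L\<^esub> {k \<odot> x | k. k \<in> carrier F}) F L"
  unfolding leibniz_subalgebra_def
proof (intro conjI ballI)
  let ?Fx = "{k \<odot> x | k. k \<in> carrier F}"
  show U: "submodule (I <+>\<^bsub>L\<^esub> ?Fx) F L"
    using submodule_sum I_submodule submodule_line x by blast
  fix a b assume a: "a \<in> I <+>\<^bsub>L\<^esub> ?Fx" and b: "b \<in> I <+>\<^bsub>L\<^esub> ?Fx"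
  obtain i k where i: "i \<in> I" "k \<in> carrier F" "a = i \<oplus> k \<odot> x" using a by (rule set_add_lineE)
  obtain j l where j: "j \<in> I" "l \<in> carrier F" "b = j \<oplus> l \<odot> x" using b by (rule set_add_lineE)
  have c: "i \<in> carrier L" "j \<in> carrier L" using i j I_subset by auto
  have "a \<otimes> b = (i \<otimes> j \<oplus> i \<otimes> (l \<odot> x)) \<oplus> ((k \<odot> x) \<otimes> j \<oplus> l \<odot> (k \<odot> (x \<otimes> x)))"
    using i j c x by (simp add: bracket_simps smult_r_distr M.a_ac)
  also have "\<dots> \<in> I"
    using i j c x sq leibniz_idealD(3,4)[OF ideal] submoduleE(4)[OF I_submodule] by auto
  finally show "a \<otimes> b \<in> I <+>\<^bsub>L\<^esub> ?Fx"
    using submodule_set_add_superset(1)[OF I_submodule submodule_line[OF x]] by blast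
qed

end

section \<open>Structure of an algebra with square-zero lines and supplements\<close>

text \<open>The two properties of $L/\phi(L)$ from which its structure is derived.\<close>

locale line_closed_leibniz_algebra = leibniz_algebra +
  assumes bracket_span: "\<lbrakk>z \<in> carrier L; w \<in> carrier L; z \<otimes> z = \<zero>; w \<otimes> w = \<zero>\<rbrakk> \<Longrightarrow>
      \<exists>a\<in>carrier F. \<exists>b\<in>carrier F. z \<otimes> w = a \<odot> z \<oplus> b \<odot> w"
    and supplement: "x \<in> carrier L \<Longrightarrow>
      \<exists>u\<in>right_annihilator L. \<exists>c\<in>carrier L. c \<otimes> c = \<zero> \<and> x = u \<oplus> c"
begin

abbreviation "K \<equiv> right_annihilator L"

lemmas K_submodule = right_annihilator_submodule
lemmas K_carrier = right_annihilatorD(1)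
lemmas K_right = right_annihilatorD(2)

text \<open>Every square vanishes, so \<open>bracket_span\<close> applies to every pair. Once [w,y]
  = w with \<open>w\<close> nonzero, the abelian ideal can only be the eigenspace \<open>A\<close>
  of right multiplication by \<open>y\<close> for the eigenvalue 1; it remains to see that
  \<open>A\<close> is abelian and that \<open>A\<close> and \<open>y\<close> span
  everything.\<close>

lemma almost_abelian_Lie:
  assumes square: "\<And>x. x \<in> carrier L \<Longrightarrow> x \<otimes> x = \<zero>"
    and nonabelian: "\<not> abelian_algebra F L"
  shows "almost_abelian F L"
proof -
  have anti: "y \<otimes> x = \<ominus> (x \<otimes> y)" if "x \<in> carrier L" "y \<in> carrier L" for x y
  proof -
    have "x \<otimes> y \<oplus> y \<otimes> x = \<zero>"
      using that square[of "x \<oplus> y"] square[of x] square[of y] by (simp add: bracket_simps M.a_comm)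
    then show ?thesis using that by (metis M.a_comm M.minus_equality bracket_closed)
  qed
  \<comment> \<open>Expand a nonzero product as [x,y] = ax + by. If a = 0, antisymmetry allows
    \<open>y\<close> with the multiple -x/b. Otherwise [[x,y],y] = a[x,y], and [x,y] with y/a will
    do.\<close>
  obtain w y where w: "w \<in> carrier L" "w \<noteq> \<zero>" and y: "y \<in> carrier L" and wy: "w \<otimes> y = w"
  proof -
    obtain x y where xy: "x \<in> carrier L" "y \<in> carrier L" "x \<otimes> y \<noteq> \<zero>"
      using nonabelian leibniz_algebra_axioms by (auto simp: abelian_algebra_def)
    obtain a b where ab: "a \<in> carrier F" "b \<in> carrier F" "x \<otimes> y = a \<odot> x \<oplus> b \<odot> y"
      using bracket_span xy square by metis
    show thesis
    proof (cases "a = \<zero>\<^bsub>F\<^esub>")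
      case True
      then have e: "x \<otimes> y = b \<odot> y" using ab xy by simp
      then have b: "b \<noteq> \<zero>\<^bsub>F\<^esub>" using xy by auto
      have inv: "inv\<^bsub>F\<^esub> b \<in> carrier F" using ab b F.field_Units by auto
      have "y \<otimes> (\<ominus> (inv\<^bsub>F\<^esub> b \<odot> x)) = inv\<^bsub>F\<^esub> b \<odot> (x \<otimes> y)"
        using xy inv anti[of x y]
        by (simp add: bracket_simps smult_r_minus)
      also have "\<dots> = y" using e smult_inverse_cancel[OF ab(2) b xy(2)] by simp
      finally have "y \<otimes> (\<ominus> (inv\<^bsub>F\<^esub> b \<odot> x)) = y" .
      moreover have "y \<noteq> \<zero>" using e ab xy by auto
      ultimately show thesis
        using xy inv by (intro that[of y "\<ominus> (inv\<^bsub>F\<^esub> b \<odot> x)"]) auto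
    next
      case False
      have inv: "inv\<^bsub>F\<^esub> a \<in> carrier F" using ab False F.field_Units by auto
      let ?v = "x \<otimes> y"
      have "?v \<otimes> y = a \<odot> ?v"
        using ab xy square by (simp add: bracket_simps)
      then have "?v \<otimes> (inv\<^bsub>F\<^esub> a \<odot> y) = ?v"
        using inv xy smult_inverse_cancel[OF ab(1) False, of ?v]
        by (simp add: bracket_simps)
      then show thesis
        using xy inv by (intro that[of ?v "inv\<^bsub>F\<^esub> a \<odot> y"]) auto
    qed
  qed
  define A where "A = {a \<in> carrier L. a \<otimes> y = a}"
  have A: "submodule A F L"
    using y by (intro submoduleI) (auto simp: A_def bracket_simps)
  have A_abelian: "a \<otimes> b = \<zero>" if ab: "a \<in> A" "b \<in> A" for a b
  proof -
    have c: "a \<in> carrier L" "b \<in> carrier L" "a \<otimes> y = a" "b \<otimes> y = b" using ab by (auto simp: A_def)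
    obtain p q where "p \<in> carrier F" "q \<in> carrier F" "a \<otimes> b = p \<odot> a \<oplus> q \<odot> b"
      using bracket_span square c by metis
    \<comment> \<open>Being a combination of \<open>a\<close> and \<open>b\<close>, the product
      [a,b] is again fixed by right multiplication by \<open>y\<close>. The Leibniz identity then
      turns [a,b] = [a,[b,y]] into [a,b] - [a,b].\<close>
    then have "(a \<otimes> b) \<otimes> y = a \<otimes> b" using c y by (simp add: bracket_simps)
    then have "a \<otimes> (b \<otimes> y) = a \<otimes> b \<ominus> a \<otimes> b"
      using leibniz_identity[of a b y] c y by simp
    then show ?thesis using c by (simp add: a_minus_def M.r_neg)
  qed
  let ?Fy = "{k \<odot> y | k. k \<in> carrier F}"
  have Fy: "submodule ?Fy F L" using submodule_line[OF y] .
  note AFy = submodule_sum[OF A Fy]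
  have w_in: "w \<in> A" using w wy by (simp add: A_def)
  have total: "z \<in> A <+>\<^bsub>L\<^esub> ?Fy" if z: "z \<in> carrier L" for z
  proof -
    \<comment> \<open>The vector \<open>w\<close> with known eigenvalue 1 is used as a probe:
      expanding [w + z,y] in two ways either determines the coefficient \<open>f\<close> or exhibits
      a nonzero multiple of \<open>z\<close> in the span of \<open>w\<close> and
      \<open>y\<close>.\<close>
    obtain f g where fg: "f \<in> carrier F" "g \<in> carrier F" "z \<otimes> y = f \<odot> z \<oplus> g \<odot> y"
      using bracket_span z y square by metis
    obtain f' g' where fg': "f' \<in> carrier F" "g' \<in> carrier F"
      "(w \<oplus> z) \<otimes> y = f' \<odot> (w \<oplus> z) \<oplus> g' \<odot> y"
      using bracket_span[of "w \<oplus> z" y] z y w square by auto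
    then have rel: "w \<oplus> (f \<odot> z \<oplus> g \<odot> y) = (f' \<odot> w \<oplus> f' \<odot> z) \<oplus> g' \<odot> y"
      using fg z y w wy by (simp add: bracket_simps smult_r_distr)
    show ?thesis
    proof (cases "f' = f")
      case True
      have "w \<oplus> g \<odot> y = f \<odot> w \<oplus> g' \<odot> y"
      proof -
        have "f \<odot> z \<oplus> (w \<oplus> g \<odot> y) = f \<odot> z \<oplus> (f \<odot> w \<oplus> g' \<odot> y)"
          using rel True fg fg' z y w by (simp add: M.a_ac)
        then show ?thesis using fg fg' z y w by simp
      qed
      \<comment> \<open>One more bracket with \<open>y\<close> kills the multiples of
        \<open>y\<close> and leaves w = fw, so f = 1 and [z,y] = z + gy. Hence z + gy is fixed and
        belongs to \<open>A\<close>.\<close>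
      then have "(w \<oplus> g \<odot> y) \<otimes> y = (f \<odot> w \<oplus> g' \<odot> y) \<otimes> y" by simp
      then have "\<one>\<^bsub>F\<^esub> \<odot> w = f \<odot> w"
        using fg fg' y w wy square by (simp add: bracket_simps)
      then have "f = \<one>\<^bsub>F\<^esub>" using smult_right_cancel[of "\<one>\<^bsub>F\<^esub>" f w] fg w by simp
      then have "z \<oplus> g \<odot> y \<in> A"
        using fg z y square by (simp add: A_def bracket_simps)
      then have "(z \<oplus> g \<odot> y) \<oplus> (\<ominus>\<^bsub>F\<^esub> g) \<odot> y \<in> A <+>\<^bsub>L\<^esub> ?Fy"
        using fg by (intro set_addI line_mem) auto
      moreover have "(z \<oplus> g \<odot> y) \<oplus> (\<ominus>\<^bsub>F\<^esub> g) \<odot> y = z"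
        using fg z y by (simp add: smult_l_minus M.a_assoc M.r_neg)
      ultimately show ?thesis by simp
    next
      case False
      have mem: "w \<in> A <+>\<^bsub>L\<^esub> ?Fy" "y \<in> A <+>\<^bsub>L\<^esub> ?Fy"
        using submodule_set_add_superset[OF A Fy] w_in line_mem[of "\<one>\<^bsub>F\<^esub>" y] y by auto
      have "f' \<odot> z \<ominus> f \<odot> z = (w \<oplus> g \<odot> y) \<ominus> (f' \<odot> w \<oplus> g' \<odot> y)"
      proof -
        have "f' \<odot> z \<oplus> (f' \<odot> w \<oplus> g' \<odot> y) = f \<odot> z \<oplus> (w \<oplus> g \<odot> y)"
          using rel fg fg' z y w by (simp add: M.a_ac)
        then show ?thesis by (rule minus_eq_minus_of_add_eq[rotated 4]) (use fg fg' z y w in auto)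
      qed
      also have "\<dots> \<in> A <+>\<^bsub>L\<^esub> ?Fy"
        using mem fg fg' submoduleE(4,5)[OF AFy] by (intro submodule_minus[OF AFy]) auto
      finally have mem': "(f' \<ominus>\<^bsub>F\<^esub> f) \<odot> z \<in> A <+>\<^bsub>L\<^esub> ?Fy"
        using fg fg' z by (simp add: smult_minus_left)
      have "f' \<ominus>\<^bsub>F\<^esub> f \<noteq> \<zero>\<^bsub>F\<^esub>"
        using False fg fg' minus_nonzero by auto
      then show ?thesis
        using submodule_smult_cancel[OF AFy _ _ z mem'] fg fg' by simp
    qed
  qed
  have eq: "carrier L = A <+>\<^bsub>L\<^esub> ?Fy" using total submoduleE(1)[OF AFy] by blast
  have Ac: "a \<in> carrier L" if "a \<in> A" for a using that by (simp add: A_def)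
  have Ay: "a \<otimes> y = a" if "a \<in> A" for a using that by (simp add: A_def)
  have ya: "y \<otimes> a = \<ominus> a" if "a \<in> A" for a using that anti[of a y] y by (simp add: A_def)
  have "leibniz_ideal A F L"
    unfolding leibniz_ideal_def
  proof (intro conjI ballI A)
    fix a z assume a: "a \<in> A" and z: "z \<in> carrier L"
    obtain b k where b: "b \<in> A" "k \<in> carrier F" "z = b \<oplus> k \<odot> y"
      using total[OF z] by (rule set_add_lineE)
    have "a \<otimes> z = k \<odot> a"
      using Ac[OF a] Ac[OF b(1)] b(2,3) y Ay[OF a] A_abelian[OF a b(1)] by (simp add: bracket_simps)
    then show "a \<otimes> z \<in> A" using submoduleE(4)[OF A] a b by simp
    then show "z \<otimes> a \<in> A" using anti[of a z] Ac[OF a] z submoduleE(3)[OF A] by simp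
  qed
  moreover have "A \<noteq> {\<zero>}" using w_in w by auto
  ultimately show ?thesis
    unfolding almost_abelian_def
    by (intro conjI exI[of _ A] exI[of _ y] ballI disjI1 leibniz_algebra_axioms A_abelian
      square eq Ay ya y)
qed

text \<open>The abelian ideal is K itself. The products [K,K] and [y,K] vanish by its definition, so
  the work is to find \<open>y\<close> acting as the identity on K and to show that nothing lies
  outside K + Fy.\<close>

lemma almost_abelian_non_Lie:
  assumes x0: "x\<^sub>0 \<in> carrier L" "x\<^sub>0 \<otimes> x\<^sub>0 \<noteq> \<zero>"
  shows "almost_abelian F L"
proof -
  note Kc = K_carrier
  have eig: "\<exists>a\<in>carrier F. \<forall>w\<in>K. w \<otimes> c = a \<odot> w" if c: "c \<in> carrier L" "c \<otimes> c = \<zero>" for c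
  proof (rule scalar_of_eigenvectors[OF K_submodule])
    fix w assume w: "w \<in> K"
    show "w \<otimes> c \<in> carrier L" using w c Kc by auto
    show "\<exists>a\<in>carrier F. w \<otimes> c = a \<odot> w"
    proof (cases "c \<in> K")
      case True
      then have "w \<otimes> c = \<zero>\<^bsub>F\<^esub> \<odot> w" using K_right[OF True] Kc[OF w] by simp
      then show ?thesis by blast
    next
      case False
      \<comment> \<open>Elements of K have square zero, so \<open>bracket_span\<close> applies. As K
        is an ideal, the term \<open>b \<odot> c\<close> lies in K; with \<open>c\<close> outside K
        this forces b = 0.\<close>
      obtain a b where ab: "a \<in> carrier F" "b \<in> carrier F" "w \<otimes> c = a \<odot> w \<oplus> b \<odot> c"
        using bracket_span[of w c] Kc[OF w] K_right[OF w] c by auto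
      have "b \<odot> c = w \<otimes> c \<ominus> a \<odot> w"
        using ab c Kc[OF w] by (simp add: a_minus_def M.a_comm[of "a \<odot> w"] M.a_assoc M.r_neg)
      also have "\<dots> \<in> K"
        by (intro submodule_minus[OF K_submodule] submoduleE(4)[OF K_submodule]
          leibniz_idealD(3)[OF right_annihilator_ideal] w c ab(1))
      finally have "b = \<zero>\<^bsub>F\<^esub>"
        using submodule_smult_cancel[OF K_submodule ab(2) _ c(1)] False by blast
      then show ?thesis using ab c Kc[OF w] by auto
    qed
  qed (use c Kc in \<open>auto simp: bracket_simps\<close>)
  obtain u\<^sub>0 c\<^sub>0 where uc: "u\<^sub>0 \<in> K" "c\<^sub>0 \<in> carrier L" "c\<^sub>0 \<otimes> c\<^sub>0 = \<zero>" "x\<^sub>0 = u\<^sub>0 \<oplus> c\<^sub>0"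
    using supplement[OF x0(1)] by blast
  obtain \<alpha> where \<alpha>: "\<alpha> \<in> carrier F" "\<And>w. w \<in> K \<Longrightarrow> w \<otimes> c\<^sub>0 = \<alpha> \<odot> w"
    using eig[OF uc(2,3)] by blast
  \<comment> \<open>Of the four products only [\<open>u\<^sub>0\<close>,\<open>c\<^sub>0\<close>]
    survives, so the nonzero square supplies both a nonzero scalar and a nonzero vector of
    K.\<close>
  have "x\<^sub>0 \<otimes> x\<^sub>0 = \<alpha> \<odot> u\<^sub>0"
    using uc \<alpha> Kc[OF uc(1)] K_right[OF uc(1)] by (simp add: bracket_simps)
  then have nz: "\<alpha> \<noteq> \<zero>\<^bsub>F\<^esub>" "u\<^sub>0 \<noteq> \<zero>" "u\<^sub>0 \<in> carrier L" using x0 \<alpha> Kc[OF uc(1)] by auto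
  have inv: "inv\<^bsub>F\<^esub> \<alpha> \<in> carrier F" using nz \<alpha> F.field_Units by auto
  define y where "y = inv\<^bsub>F\<^esub> \<alpha> \<odot> c\<^sub>0"
  have y: "y \<in> carrier L" "y \<otimes> y = \<zero>"
    using inv uc by (auto simp: y_def bracket_simps)
  have wy: "w \<otimes> y = w" if w: "w \<in> K" for w
    using inv uc w Kc[OF w] \<alpha> smult_inverse_cancel[OF \<alpha>(1) nz(1)]
    by (simp add: y_def bracket_simps)
  have span_y: "\<exists>a\<in>carrier F. d \<otimes> y = a \<odot> d" "\<exists>p\<in>carrier F. y \<otimes> d = p \<odot> d"
    if d: "d \<in> carrier L" "d \<otimes> d = \<zero>" and Kd: "\<And>w. w \<in> K \<Longrightarrow> w \<otimes> d = \<zero>" for d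
  proof -
    \<comment> \<open>Left multiplication by \<open>u\<^sub>0\<close> reads off the coefficient of
      \<open>y\<close>, since \<open>d\<close> annihilates K and \<open>y\<close> fixes it. By the
      Leibniz identity it kills [d,y] and [y,d], so neither has a \<open>y\<close>-part.\<close>
    have u: "u\<^sub>0 \<otimes> (a \<odot> d \<oplus> b \<odot> y) = b \<odot> u\<^sub>0" if "a \<in> carrier F" "b \<in> carrier F" for a b
      using that d y nz Kd[OF uc(1)] wy[OF uc(1)] by (simp add: bracket_simps)
    have z: "u\<^sub>0 \<otimes> (d \<otimes> y) = \<zero>" "u\<^sub>0 \<otimes> (y \<otimes> d) = \<zero>"
      using d y nz Kd[OF uc(1)] wy[OF uc(1)] by (auto simp: leibniz_identity a_minus_def)
    have b0: "b = \<zero>\<^bsub>F\<^esub>" if "b \<in> carrier F" "b \<odot> u\<^sub>0 = \<zero>" for b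
      using smult_right_cancel[of b "\<zero>\<^bsub>F\<^esub>" "u\<^sub>0"] that nz by simp
    obtain a b where ab: "a \<in> carrier F" "b \<in> carrier F" "d \<otimes> y = a \<odot> d \<oplus> b \<odot> y"
      using bracket_span d y by metis
    then have "b = \<zero>\<^bsub>F\<^esub>" using b0 u z(1) by simp
    then show "\<exists>a\<in>carrier F. d \<otimes> y = a \<odot> d" using ab d y by auto
    obtain q p where pq: "q \<in> carrier F" "p \<in> carrier F" "y \<otimes> d = q \<odot> y \<oplus> p \<odot> d"
      using bracket_span d y by metis
    then have "y \<otimes> d = p \<odot> d \<oplus> q \<odot> y" using d y by (simp add: M.a_comm)
    then have "q = \<zero>\<^bsub>F\<^esub>" using b0 u[of p q] pq z(2) by simp
    then show "\<exists>p\<in>carrier F. y \<otimes> d = p \<odot> d" using pq d y by auto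
  qed
  have centralizer: "c \<in> K"
    if c: "c \<in> carrier L" "c \<otimes> c = \<zero>" and Kcc: "\<And>w. w \<in> K \<Longrightarrow> w \<otimes> c = \<zero>" for c
  proof (rule ccontr)
    assume nK: "c \<notin> K"
    have c0: "c \<noteq> \<zero>" using nK submodule_zero[OF K_submodule] by auto
    \<comment> \<open>As \<open>c\<close> lies outside K, coefficients of \<open>c\<close> may be
      compared modulo K.\<close>
    have scal: "a = b" if ab: "a \<in> carrier F" "b \<in> carrier F"
      and eq: "a \<odot> c \<oplus> r = b \<odot> c \<oplus> s" and rs: "r \<in> K" "s \<in> K" for a b r s
    proof (rule ccontr)
      assume "a \<noteq> b"
      then have "a \<ominus>\<^bsub>F\<^esub> b \<noteq> \<zero>\<^bsub>F\<^esub>" "a \<ominus>\<^bsub>F\<^esub> b \<in> carrier F"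
        using ab minus_nonzero by auto
      moreover have "(a \<ominus>\<^bsub>F\<^esub> b) \<odot> c = s \<ominus> r"
        using eq ab c Kc[OF rs(1)] Kc[OF rs(2)]
          minus_eq_minus_of_add_eq[of "a \<odot> c" r "b \<odot> c" s] by (simp add: smult_minus_left)
      then have "(a \<ominus>\<^bsub>F\<^esub> b) \<odot> c \<in> K" using submodule_minus[OF K_submodule] rs by simp
      ultimately show False using submodule_smult_cancel[OF K_submodule _ _ c(1)] nK by blast
    qed
    let ?d = "u\<^sub>0 \<oplus> c"
    have d: "?d \<in> carrier L" "?d \<otimes> ?d = \<zero>" "\<And>w. w \<in> K \<Longrightarrow> w \<otimes> ?d = \<zero>"
      using c Kcc Kc K_right[OF uc(1)] nz uc by (auto simp: bracket_simps)
    obtain a where a: "a \<in> carrier F" "c \<otimes> y = a \<odot> c" using span_y(1) c Kcc by metis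
    obtain a' where a': "a' \<in> carrier F" "?d \<otimes> y = a' \<odot> ?d" using span_y(1) d by metis
    obtain p where p: "p \<in> carrier F" "y \<otimes> c = p \<odot> c" using span_y(2) c Kcc by metis
    obtain p' where p': "p' \<in> carrier F" "y \<otimes> ?d = p' \<odot> ?d" using span_y(2) d by metis
    have sm: "k \<odot> u\<^sub>0 \<in> K" if "k \<in> carrier F" for k
      using submoduleE(4)[OF K_submodule] that uc by blast
    have e1: "a \<odot> c \<oplus> u\<^sub>0 = a' \<odot> c \<oplus> a' \<odot> u\<^sub>0"
      using a a' c nz y wy[OF uc(1)] by (simp add: bracket_simps smult_r_distr M.a_comm)
    then have aa: "a = a'" using scal a a' sm uc by blast
    then have "u\<^sub>0 = a \<odot> u\<^sub>0" using e1 a c nz by simp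
    then have a1: "a = \<one>\<^bsub>F\<^esub>" using smult_right_cancel[of a "\<one>\<^bsub>F\<^esub>" "u\<^sub>0"] a nz by simp
    have e2: "p \<odot> c \<oplus> \<zero> = p' \<odot> c \<oplus> p' \<odot> u\<^sub>0"
      using p p' c nz y K_right[OF uc(1)] by (simp add: bracket_simps smult_r_distr M.a_comm)
    then have pp: "p = p'" using scal p p' sm submodule_zero[OF K_submodule] by blast
    then have "p \<odot> c \<oplus> p \<odot> u\<^sub>0 = p \<odot> c \<oplus> \<zero>" using e2 by simp
    then have "p \<odot> u\<^sub>0 = \<zero>" using p c nz by (simp del: M.r_zero)
    then have p0: "p = \<zero>\<^bsub>F\<^esub>" using smult_right_cancel[of p "\<zero>\<^bsub>F\<^esub>" "u\<^sub>0"] p nz by simp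
    \<comment> \<open>The comparisons with \<open>?d\<close> have forced [c,y] = c and [y,c] = 0. So
      \<open>c\<close> would be the square of c + y, yet squares lie in K.\<close>
    have "(c \<oplus> y) \<otimes> (c \<oplus> y) = c"
      using c y a p a1 p0 by (simp add: bracket_simps)
    then show False using square_in_right_annihilator[of "c \<oplus> y"] c y nK by simp
  qed
  let ?Fy = "{k \<odot> y | k. k \<in> carrier F}"
  have "z \<in> K <+>\<^bsub>L\<^esub> ?Fy" if z: "z \<in> carrier L" for z
  proof -
    have *: "\<exists>u\<in>K. \<exists>c\<in>carrier L. \<exists>a\<in>carrier F. c \<otimes> c = \<zero> \<and> x = u \<oplus> c \<and> (\<forall>w\<in>K. w \<otimes> c = a \<odot> w)"
      if "x \<in> carrier L" for x
      using supplement[OF that] eig by blast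
    obtain u c a where c: "u \<in> K" "c \<in> carrier L" "a \<in> carrier F" "z = u \<oplus> c"
      "\<And>w. w \<in> K \<Longrightarrow> w \<otimes> c = a \<odot> w"
      using *[OF z] by blast
    \<comment> \<open>Subtracting the right multiple of \<open>y\<close> cancels the action on K,
      but the difference need not have square zero. A second splitting by \<open>supplement\<close>
      repairs this: its K-part acts trivially on K, so the other part still annihilates K and
      \<open>centralizer\<close> applies.\<close>
    let ?x = "c \<ominus> a \<odot> y"
    have x: "?x \<in> carrier L" using c y by simp
    have Kx: "w \<otimes> ?x = \<zero>" if w: "w \<in> K" for w
      using c w wy[OF w] y Kc[OF w] by (simp add: a_minus_def bracket_simps M.r_neg)
    obtain v e b where e: "v \<in> K" "e \<in> carrier L" "e \<otimes> e = \<zero>" "?x = v \<oplus> e"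
      using *[OF x] by blast
    have "w \<otimes> e = \<zero>" if w: "w \<in> K" for w
      using Kx[OF w] e Kc[OF w] Kc[OF e(1)] K_right[OF e(1)] by (simp add: bracket_simps)
    then have "e \<in> K" using centralizer e by blast
    then have "?x \<in> K" using e submoduleE(5)[OF K_submodule] by simp
    then have "u \<oplus> ?x \<in> K" using c submoduleE(5)[OF K_submodule] by simp
    then have "(u \<oplus> ?x) \<oplus> a \<odot> y \<in> K <+>\<^bsub>L\<^esub> ?Fy"
      using c(3) by (intro set_addI line_mem)
    moreover have "(u \<oplus> ?x) \<oplus> a \<odot> y = z"
      using c y Kc[OF c(1)] by (simp add: a_minus_def M.a_assoc M.l_neg)
    ultimately show ?thesis by simp
  qed
  then have eq: "carrier L = K <+>\<^bsub>L\<^esub> ?Fy"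
    using submoduleE(1)[OF submodule_sum[OF K_submodule submodule_line[OF y(1)]]] by blast
  have "K \<noteq> {\<zero>}" using uc nz by blast
  then show ?thesis
    unfolding almost_abelian_def
    by (intro conjI exI[of _ K] exI[of _ y] ballI disjI2 leibniz_algebra_axioms
      right_annihilator_ideal y wy eq K_right K_carrier)
qed

lemma abelian_or_almost_abelian: "abelian_algebra F L \<or> almost_abelian F L"
  using almost_abelian_Lie almost_abelian_non_Lie by blast

end

section \<open>Passage to the Frattini quotient\<close>

theorem lemma3p2:
  fixes F :: "('k, 'm) ring_scheme" and L :: "('k, 'v, 'n) module_scheme"
  assumes "leibniz_algebra F L"
    and "finite_dimensional F L"
    and "\<And>U. leibniz_subalgebra U F L \<Longrightarrow> weak_quasi_ideal U F L"
  shows "abelian_algebra F (quotient_algebra L (frattini_ideal F L)) \<or>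
         almost_abelian F (quotient_algebra L (frattini_ideal F L))"
proof -
  interpret leibniz_algebra F L by fact
  let ?I = "frattini_ideal F L"
  interpret leibniz_quotient F L ?I
    using frattini_ideal_greatest(1) by unfold_locales
  interpret Q: leibniz_algebra F Q by (rule leibniz_algebra_quotient)
  have "line_closed_leibniz_algebra F Q"
  proof (intro line_closed_leibniz_algebra.intro line_closed_leibniz_algebra_axioms.intro Q.leibniz_algebra_axioms)
    fix X Y assume X: "X \<in> carrier Q" "X \<otimes>\<^bsub>Q\<^esub> X = \<zero>\<^bsub>Q\<^esub>"
      and Y: "Y \<in> carrier Q" "Y \<otimes>\<^bsub>Q\<^esub> Y = \<zero>\<^bsub>Q\<^esub>"
    obtain x where x: "x \<in> carrier L" "X = proj x" using X(1) by (rule Q_carrierE)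
    obtain y where y: "y \<in> carrier L" "Y = proj y" using Y(1) by (rule Q_carrierE)
    have sq: "x \<otimes>\<^bsub>L\<^esub> x \<in> ?I" "y \<otimes>\<^bsub>L\<^esub> y \<in> ?I"
      using X Y x y by (simp_all add: proj_mult proj_eq_I_iff quotient_algebra_sel(2))
    let ?U = "?I <+>\<^bsub>L\<^esub> {k \<odot>\<^bsub>L\<^esub> x | k. k \<in> carrier F}"
    let ?V = "?I <+>\<^bsub>L\<^esub> {k \<odot>\<^bsub>L\<^esub> y | k. k \<in> carrier F}"
    have UV: "leibniz_subalgebra ?U F L" "leibniz_subalgebra ?V F L"
      using leibniz_subalgebra_ideal_line x y sq by auto
    have mem: "z \<in> ?I <+>\<^bsub>L\<^esub> {k \<odot>\<^bsub>L\<^esub> z | k. k \<in> carrier F}" if z: "z \<in> carrier L" for z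
      using set_addI[OF I.zero_closed line_mem[OF F.one_closed, of z]] z by simp
    have "x \<otimes>\<^bsub>L\<^esub> y \<in> ?U <+>\<^bsub>L\<^esub> ?V"
      using weak_quasi_ideal_bracket[OF assms(3)[OF UV(1)] UV(2)] mem x y by simp
    then obtain u v where u: "u \<in> ?U" and v: "v \<in> ?V" and uv: "x \<otimes>\<^bsub>L\<^esub> y = u \<oplus>\<^bsub>L\<^esub> v"
      unfolding set_add_iff[of _ ?U ?V] by blast
    obtain i a where i: "i \<in> ?I" "a \<in> carrier F" "u = i \<oplus>\<^bsub>L\<^esub> a \<odot>\<^bsub>L\<^esub> x"
      using u by (rule set_add_lineE)
    obtain j b where j: "j \<in> ?I" "b \<in> carrier F" "v = j \<oplus>\<^bsub>L\<^esub> b \<odot>\<^bsub>L\<^esub> y"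
      using v by (rule set_add_lineE)
    have "proj (x \<otimes>\<^bsub>L\<^esub> y) = proj u \<oplus>\<^bsub>Q\<^esub> proj v"
      using i j x y I_subset by (subst proj_add) (auto simp: uv)
    also have "\<dots> = a \<odot>\<^bsub>Q\<^esub> X \<oplus>\<^bsub>Q\<^esub> b \<odot>\<^bsub>Q\<^esub> Y"
      using i j x y by (simp add: proj_add_left proj_smult)
    finally show "\<exists>a\<in>carrier F. \<exists>b\<in>carrier F. X \<otimes>\<^bsub>Q\<^esub> Y = a \<odot>\<^bsub>Q\<^esub> X \<oplus>\<^bsub>Q\<^esub> b \<odot>\<^bsub>Q\<^esub> Y"
      using i(2) j(2) x y by (auto simp: proj_mult)
  next
    fix X assume "X \<in> carrier Q"
    then obtain x where x: "x \<in> carrier L" "X = proj x" by (rule Q_carrierE)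
    \<comment> \<open>The supplement is taken in \<open>L\<close> itself: the square of
      \<open>c\<close> lies in \<open>C\<close> and in the annihilator, so it dies in the quotient,
      while the annihilator of \<open>L\<close> maps into that of the quotient.\<close>
    obtain C where C: "leibniz_subalgebra C F L" "right_annihilator L <+>\<^bsub>L\<^esub> C = carrier L"
      "right_annihilator L \<inter> C \<subseteq> ?I"
      using right_annihilator_supplement[OF assms(2)] .
    obtain u c where u: "u \<in> right_annihilator L" "c \<in> C" "x = u \<oplus>\<^bsub>L\<^esub> c"
      using x(1) C(2) by (metis set_add_iff)
    have c: "u \<in> carrier L" "c \<in> carrier L"
      using u right_annihilatorD(1) leibniz_subalgebraD(2)[OF C(1)] by auto
    have "c \<otimes>\<^bsub>L\<^esub> c \<in> ?I"
      using C(3) square_in_right_annihilator[OF c(2)] leibniz_subalgebraD(3)[OF C(1) u(2) u(2)] by blast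
    then have "proj c \<otimes>\<^bsub>Q\<^esub> proj c = \<zero>\<^bsub>Q\<^esub>"
      using c by (simp add: proj_mult proj_eq_I_iff quotient_algebra_sel(2))
    moreover have "proj u \<in> right_annihilator Q"
      unfolding right_annihilator_def
      using c right_annihilatorD(2)[OF u(1)]
      by (auto simp: proj_simps quotient_zero elim!: Q_carrierE)
    ultimately show "\<exists>u\<in>right_annihilator Q. \<exists>c\<in>carrier Q. c \<otimes>\<^bsub>Q\<^esub> c = \<zero>\<^bsub>Q\<^esub> \<and> X = u \<oplus>\<^bsub>Q\<^esub> c"
      using c x u by (intro bexI[of _ "proj u"] bexI[of _ "proj c"]) (simp_all add: proj_simps)
  qed
  then show ?thesis by (rule line_closed_leibniz_algebra.abelian_or_almost_abelian)
qed

end
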